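(* Fix $\sigma>0$, $\lambda>0$, $N\ge1$ and $\beta>0$. Assume that the noise distribution $\Psi$ has mean $0$ and variance $1$. Then, in dimension $d=2$, the optimally tuned worst-case risk of linear filtering over $\mathrm{CPLIP}=\mathrm{CPLIP}(\lambda,\beta,N)$ satisfies $$\inf_{h>0}\mathcal{R}_n(L_h;\mathrm{CPLIP})\asymp n^{-2/3},\qquad n\to\infty .$$
   Context: Model ($d=2$): let $\mathbb{I}_n=\{1,\dots,n\}$. One observes $Y_n(\mathbf{i})=f(\mathbf{i}/n)+\sigma Z_n(\mathbf{i})$, $\mathbf{i}\in\mathbb{I}_n^2$, where $f:[0,1]^2\to[0,1]$ is unknown, $\sigma>0$ is a fixed noise level and $(Z_n(\mathbf{i}))_{\mathbf{i}\in\mathbb{I}_n^2}$ is white noise, i.e. i.i.d. random variables with distribution $\Psi$. Linear filter: for $h>0$ let $\mathcal{W}[n,h](\mathbf{i})=\{\mathbf{j}\in\mathbb{I}_n^2:\|\mathbf{j}-\mathbf{i}\|\le nh\}$ (Euclidean norm) and $L_h[Y_n](\mathbf{i})=\mathrm{Average}\{Y_n(\mathbf{j}):\mathbf{j}\in\mathcal{W}[n,h](\mathbf{i})\}$. Risk: for an estimator $T$, $\mathcal{R}_n(T;f)=\frac1{n^2}\sum_{\mathbf{i}\in\mathbb{I}_n^2}\mathbb{E}[(T[Y_n](\mathbf{i})-f(\mathbf{i}/n))^2]$, and for a class $\mathcal{F}$ of functions, $\mathcal{R}_n(T;\mathcal{F})=\sup_{f\in\mathcal{F}}\mathcal{R}_n(T;f)$.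 Function class: the local Lipschitz constant of $f$ at $x$ is $\mathrm{Lip}_x(f)=\limsup_{\varepsilon\to0}\sup_{|y-x|\le\varepsilon,\,y\ne x}\frac{|f(y)-f(x)|}{|y-x|}$. $\Gamma(\lambda)$ is the class of rectifiable curves in $[0,1]^2$ with length at most $\lambda$; $\mathcal{C}(N,\lambda)$ is the collection of complexes (finite collections of curves) composed of at most $N$ curves from $\Gamma(\lambda)$. $\mathrm{CPLIP}(\lambda,\beta,N)$ is the collection of functions $f:[0,1]^2\to[0,1]$ having local Lipschitz constant bounded by $\beta$ at every point of the complement of (the union of the curves of) some complex in $\mathcal{C}(N,\lambda)$, which may depend on $f$. $a_n\asymp b_n$ means that the ratio $a_n/b_n$ is bounded away from $0$ and $\infty$ as $n$ becomes large (constants may depend on $\sigma,\lambda,\beta,N,\Psi$). *)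

theory Defs
  imports "HOL-Probability.Probability" "HOL-Library.Landau_Symbols"
begin

definition grid :: "nat \<Rightarrow> (nat \<times> nat) set" where
  "grid n = {1..n} \<times> {1..n}"

definition unit_square :: "(real \<times> real) set" where
  "unit_square = {0..1} \<times> {0..1}"

definition real_pair :: "nat \<times> nat \<Rightarrow> real \<times> real" where
  "real_pair i = (real (fst i), real (snd i))"

definition design_point :: "nat \<Rightarrow> nat \<times> nat \<Rightarrow> real \<times> real" where
  "design_point n i = (real (fst i) / real n, real (snd i) / real n)"


definition observation ::
    "nat \<Rightarrow> real \<Rightarrow> (real \<times> real \<Rightarrow> real) \<Rightarrow> (nat \<times> nat \<Rightarrow> 'a \<Rightarrow> real) \<Rightarrow> 'a \<Rightarrow> nat \<times> nat \<Rightarrow> real" where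
  "observation n \<sigma> f Z \<omega> i = f (design_point n i) + \<sigma> * Z i \<omega>"

text \<open>The norm on \<^typ>\<open>real \<times> real\<close> is the Euclidean one.\<close>

definition window :: "nat \<Rightarrow> real \<Rightarrow> nat \<times> nat \<Rightarrow> (nat \<times> nat) set" where
  "window n h i = {j \<in> grid n. norm (real_pair j - real_pair i) \<le> real n * h}"

definition linear_filter ::
    "nat \<Rightarrow> real \<Rightarrow> (nat \<times> nat \<Rightarrow> real) \<Rightarrow> nat \<times> nat \<Rightarrow> real" where
  "linear_filter n h Y i = (\<Sum>j\<in>window n h i. Y j) / real (card (window n h i))"


definition risk ::
    "'a measure \<Rightarrow> nat \<Rightarrow> real \<Rightarrow> (nat \<times> nat \<Rightarrow> 'a \<Rightarrow> real)
      \<Rightarrow> ((nat \<times> nat \<Rightarrow> real) \<Rightarrow> nat \<times> nat \<Rightarrow> real) \<Rightarrow> (real \<times> real \<Rightarrow> real) \<Rightarrow> real" where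
  "risk M n \<sigma> Z T f =
     1 / (real n)^2 *
     (\<Sum>i\<in>grid n. \<integral>\<omega>. (T (observation n \<sigma> f Z \<omega>) i - f (design_point n i))^2 \<partial>M)"

text \<open>
  The supremum is taken in the reals. For linear filters, noise of mean 0 and variance 1, and a
  class of functions with values in the unit interval, the risks are bounded by
  \<open>1 + \<sigma>\<^sup>2\<close>, so this is a genuine supremum.
\<close>

definition worst_case_risk ::
    "'a measure \<Rightarrow> nat \<Rightarrow> real \<Rightarrow> (nat \<times> nat \<Rightarrow> 'a \<Rightarrow> real)
      \<Rightarrow> ((nat \<times> nat \<Rightarrow> real) \<Rightarrow> nat \<times> nat \<Rightarrow> real) \<Rightarrow> (real \<times> real \<Rightarrow> real) set \<Rightarrow> real" where
  "worst_case_risk M n \<sigma> Z T F = (SUP f\<in>F. risk M n \<sigma> Z T f)"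


text \<open>
  Functions on the unit square are represented by total functions on the plane; the points
  \<open>y\<close> below are restricted to the square so that values outside it play no role.
\<close>

definition local_lip :: "(real \<times> real \<Rightarrow> real) \<Rightarrow> real \<times> real \<Rightarrow> ereal" where
  "local_lip f x =
     Limsup (at_right 0)
       (\<lambda>\<epsilon>::real. SUP y\<in>{y \<in> unit_square. norm (y - x) \<le> \<epsilon> \<and> y \<noteq> x}.
          ereal (\<bar>f y - f x\<bar> / norm (y - x)))"

text \<open>Supremum of the lengths of inscribed polygons with vertices \<open>g (t 0), \<dots>, g (t m)\<close>.\<close>

definition curve_length :: "(real \<Rightarrow> real \<times> real) \<Rightarrow> ereal" where
  "curve_length g =
     (SUP (m, t) \<in> {(m :: nat, t :: nat \<Rightarrow> real). mono_on {..m} t \<and> t ` {..m} \<subseteq> {0..1}}.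
        ereal (\<Sum>k<m. norm (g (t (Suc k)) - g (t k))))"

text \<open>A curve whose length is bounded by a real number is in particular rectifiable.\<close>

definition rect_curves :: "real \<Rightarrow> (real \<Rightarrow> real \<times> real) set" where
  "rect_curves l = {g. path g \<and> path_image g \<subseteq> unit_square \<and> curve_length g \<le> ereal l}"

definition complexes :: "nat \<Rightarrow> real \<Rightarrow> (real \<Rightarrow> real \<times> real) set set" where
  "complexes N l = {G. finite G \<and> card G \<le> N \<and> G \<subseteq> rect_curves l}"

definition CPLIP :: "real \<Rightarrow> real \<Rightarrow> nat \<Rightarrow> (real \<times> real \<Rightarrow> real) set" where
  "CPLIP l \<beta> N =
     {f. f ` unit_square \<subseteq> {0..1} \<and>
         (\<exists>G\<in>complexes N l. \<forall>x\<in>unit_square - (\<Union>g\<in>G. path_image g). local_lip f x \<le> ereal \<beta>)}"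

end

theory Submission
  imports Defs
begin

text \<open>
  White noise of variance 1 turns the mean square error of a window average into a squared bias plus
  \<open>\<sigma>\<^sup>2\<close> divided by the number of points in the window (\<open>risk_linear_filter\<close>). For a bandwidth
  with \<open>1 / n \<le> h \<le> 1\<close> a window holds of the order of \<open>(n h)\<^sup>2\<close> points, so the variance term has
  size \<open>1 / (n h)\<^sup>2\<close>.

  The bias is governed by the curves. If no curve comes within \<open>h\<close> of a design point, the segments
  from that point to the other points of its window avoid the curves, \<open>f\<close> is \<open>\<beta>\<close>-Lipschitz along
  them (\<open>lipschitz_along_segment\<close>), and the bias is at most \<open>\<beta> h\<close>. At the remaining points the bias
  is at most 1, and these points are few: a curve of length at most \<open>l\<close> is covered by \<open>l / h + 1\<close>
  discs of radius \<open>h\<close> (\<open>net_of_curve\<close>), so a fraction of order \<open>h\<close> of the grid lies within \<open>h\<close>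
  of it. The worst-case risk is thus of order at most \<open>h + h\<^sup>2 + 1 / (n h)\<^sup>2\<close>, and
  \<open>h = n powr (-2/3)\<close> balances the first and the last term.

  Two functions show that no bandwidth does better. The zero function has pure variance risk, of
  order at least \<open>1 / (2 n h + 1)\<^sup>2\<close>, which settles all \<open>h\<close> with \<open>2 n h + 1 \<le> n powr (1/3)\<close>. For larger
  \<open>h\<close>, the indicator of a small square in a corner of the domain jumps across an L-shaped curve; for a
  fraction of order \<open>min h 1\<close> of the grid, namely the points inside the square close to its right edge, a
  fixed proportion of the window lies beyond that edge, so the squared bias is bounded below
  (\<open>corner_risk_ge\<close>).
\<close>

section \<open>Local Lipschitz constants along segments\<close>

text \<open>
  For every slope \<open>B > \<beta>\<close> the bound \<open>local_lip f z \<le> \<beta>\<close> gives increments of slope at most \<open>B\<close>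
  between \<open>z\<close> and nearby points. Such increments add up along a line, so Bolzano's subdivision
  principle extends the bound to the whole segment.
\<close>

lemma lipschitz_along_segment:
  assumes sq: "closed_segment x y \<subseteq> unit_square"
    and lip: "\<And>z. z \<in> closed_segment x y \<Longrightarrow> local_lip f z \<le> ereal \<beta>"
  shows "\<bar>f y - f x\<bar> \<le> \<beta> * norm (y - x)"
proof (rule field_le_epsilon)
  fix e :: real assume "e > 0"
  \<comment> \<open>The excess slope is chosen so that it contributes at most \<open>e\<close> over the whole segment.\<close>
  define B where "B = \<beta> + e / (norm (y - x) + 1)"
  have Bgt: "\<beta> < B"
    using \<open>e > 0\<close> by (simp add: B_def add_nonneg_pos)
  define \<gamma> where "\<gamma> t = x + t *\<^sub>R (y - x)" for t :: real
  \<comment> \<open>The range conditions are part of the predicate because the subdivision principle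
    also tests intervals that stick out of the unit interval.\<close>
  define P where "P s t \<longleftrightarrow> (0 \<le> s \<and> s \<le> t \<and> t \<le> 1 \<longrightarrow> \<bar>f (\<gamma> t) - f (\<gamma> s)\<bar> \<le> B * ((t - s) * norm (y - x)))"
    for s t
  have seg: "\<gamma> t \<in> closed_segment x y" if "0 \<le> t" "t \<le> 1" for t
    using that by (auto simp: \<gamma>_def in_segment algebra_simps intro!: exI[of _ t])
  have diff: "norm (\<gamma> t - \<gamma> s) = \<bar>t - s\<bar> * norm (y - x)" for s t
    unfolding \<gamma>_def by (simp flip: scaleR_left_diff_distrib)
  have "(0::real) \<le> 1" by simp
  then have "P 0 1"
  proof (induction rule: Bolzano)
    case (trans a b c)
    show ?case unfolding P_def
    proof
      assume h: "0 \<le> a \<and> a \<le> c \<and> c \<le> 1"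
      have "\<bar>f (\<gamma> b) - f (\<gamma> a)\<bar> \<le> B * ((b - a) * norm (y - x))"
        and "\<bar>f (\<gamma> c) - f (\<gamma> b)\<bar> \<le> B * ((c - b) * norm (y - x))"
        using trans h by (auto simp: P_def)
      then show "\<bar>f (\<gamma> c) - f (\<gamma> a)\<bar> \<le> B * ((c - a) * norm (y - x))"
        by (simp add: algebra_simps)
    qed
  next
    case (local t)
    define z where "z = \<gamma> t"
    have "local_lip f z < ereal B"
      using lip[OF seg[of t]] local Bgt by (simp add: z_def le_less_trans)
    then have "\<forall>\<^sub>F \<epsilon> in at_right (0::real). (SUP y\<in>{y \<in> unit_square. norm (y - z) \<le> \<epsilon> \<and> y \<noteq> z}.
          ereal (\<bar>f y - f z\<bar> / norm (y - z))) < ereal B"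
      unfolding local_lip_def by (rule Limsup_lessD)
    then obtain b where b: "b > 0" and sup: "\<And>\<epsilon>. 0 < \<epsilon> \<Longrightarrow> \<epsilon> < b \<Longrightarrow>
       (SUP y\<in>{y \<in> unit_square. norm (y - z) \<le> \<epsilon> \<and> y \<noteq> z}. ereal (\<bar>f y - f z\<bar> / norm (y - z))) < ereal B"
      by (auto simp: eventually_at_right_field)
    have near: "\<bar>f w - f z\<bar> \<le> B * norm (w - z)" if "w \<in> unit_square" "norm (w - z) < b" for w
    proof (cases "w = z")
      case False
      have "ereal (\<bar>f w - f z\<bar> / norm (w - z)) \<le> 
         (SUP y\<in>{y \<in> unit_square. norm (y - z) \<le> norm (w - z) \<and> y \<noteq> z}. ereal (\<bar>f y - f z\<bar> / norm (y - z)))"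
        using that False by (intro SUP_upper) auto
      also have "\<dots> < ereal B" using that False by (intro sup) auto
      finally show ?thesis using False by (simp add: field_simps)
    qed simp
    define d where "d = b / (norm (y - x) + 1)"
    have d: "d > 0" "d * norm (y - x) < b"
      using b norm_ge_zero[of "y - x"] by (simp_all add: d_def divide_simps add_nonneg_pos algebra_simps del: norm_ge_zero)
    have "P s u" if "s \<le> t" "t \<le> u" "u - s < d" for s u
      unfolding P_def
    proof
      assume h: "0 \<le> s \<and> s \<le> u \<and> u \<le> 1"
      have "(u - s) * norm (y - x) < b"
        using d that by (meson le_less_trans less_imp_le mult_right_mono norm_ge_zero)
      moreover have "(t - s) * norm (y - x) \<le> (u - s) * norm (y - x)"
         "(u - t) * norm (y - x) \<le> (u - s) * norm (y - x)"
        using that by (auto intro!: mult_right_mono)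
      ultimately have "norm (\<gamma> s - z) < b" "norm (\<gamma> u - z) < b"
        using that by (simp_all add: z_def diff)
      moreover have "\<gamma> s \<in> unit_square" "\<gamma> u \<in> unit_square"
        using h sq seg[of s] seg[of u] by auto
      ultimately have "\<bar>f (\<gamma> s) - f z\<bar> \<le> B * norm (\<gamma> s - z)" "\<bar>f (\<gamma> u) - f z\<bar> \<le> B * norm (\<gamma> u - z)"
        by (simp_all add: near)
      then show "\<bar>f (\<gamma> u) - f (\<gamma> s)\<bar> \<le> B * ((u - s) * norm (y - x))"
        using that by (simp add: z_def diff abs_minus_commute[of s t] algebra_simps)
    qed
    with d show ?case by blast
  qed
  then have "\<bar>f y - f x\<bar> \<le> B * norm (y - x)" by (simp add: P_def \<gamma>_def)
  also have "\<dots> \<le> \<beta> * norm (y - x) + e"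
    using \<open>e > 0\<close> norm_ge_zero[of "y - x"]
    by (simp add: B_def divide_simps add_nonneg_pos algebra_simps del: norm_ge_zero)
  finally show "\<bar>f y - f x\<bar> \<le> \<beta> * norm (y - x) + e" .
qed

lemma local_lip_locally_constant:
  assumes "\<delta> > 0" "\<And>y. y \<in> unit_square \<Longrightarrow> norm (y - x) \<le> \<delta> \<Longrightarrow> f y = f x"
  shows "local_lip f x \<le> 0"
  unfolding local_lip_def
proof (rule Limsup_bounded)
  show "\<forall>\<^sub>F \<epsilon> in at_right 0. (SUP y\<in>{y \<in> unit_square. norm (y - x) \<le> \<epsilon> \<and> y \<noteq> x}.
      ereal (\<bar>f y - f x\<bar> / norm (y - x))) \<le> 0"
    unfolding eventually_at_right_field
  proof (intro exI conjI allI impI SUP_least)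
    show "0 < \<delta>" by fact
    fix \<epsilon> y assume "0 < \<epsilon>" "\<epsilon> < \<delta>" "y \<in> {y \<in> unit_square. norm (y - x) \<le> \<epsilon> \<and> y \<noteq> x}"
    then have "f y = f x" by (intro assms(2)) auto
    then show "ereal (\<bar>f y - f x\<bar> / norm (y - x)) \<le> 0" by simp
  qed
qed

section \<open>Length and covering numbers of curves\<close>

text \<open>
  The separated points, listed by increasing parameter, are the vertices of an inscribed polygon in
  which each of the \<open>card S - 1\<close> edges is longer than \<open>r\<close>.
\<close>

lemma separated_points_on_curve:
  assumes len: "curve_length g \<le> ereal l" and "l > 0" "r > 0"
    and S: "finite S" "S \<subseteq> {0..1}"
    and sep: "\<And>u v. u \<in> S \<Longrightarrow> v \<in> S \<Longrightarrow> u \<noteq> v \<Longrightarrow> r < norm (g u - g v)"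
  shows "real (card S) \<le> l / r + 1"
proof (cases "S = {}")
  case True
  with \<open>l > 0\<close> \<open>r > 0\<close> show ?thesis by simp
next
  case False
  define ts where "ts = sorted_list_of_set S"
  define m where "m = card S - 1"
  have lts: "length ts = Suc m"
    using False S by (simp add: ts_def m_def card_gt_0_iff)
  have sts: "sorted_wrt (<) ts" "set ts = S" using S by (auto simp: ts_def)
  have inS: "ts ! k \<in> S" if "k \<le> m" for k
    using that lts sts(2) nth_mem[of k ts] by simp
  have step: "r \<le> norm (g (ts ! Suc k) - g (ts ! k))" if "k < m" for k
  proof -
    have "ts ! k < ts ! Suc k"
      using sts(1) that lts by (simp add: sorted_wrt_nth_less)
    then show ?thesis using sep[of "ts ! Suc k" "ts ! k"] inS that by fastforce
  qed
  have "mono_on {..m} ((!) ts)"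
    using sts(1) lts by (auto intro!: mono_onI simp: strict_sorted_iff intro: sorted_nth_mono)
  moreover have "(!) ts ` {..m} \<subseteq> {0..1}" using inS S(2) by blast
  ultimately have "ereal (\<Sum>k<m. norm (g (ts ! Suc k) - g (ts ! k))) \<le> curve_length g"
    unfolding curve_length_def by (intro SUP_upper2[of "(m, (!) ts)"]) auto
  then have "(\<Sum>k<m. norm (g (ts ! Suc k) - g (ts ! k))) \<le> l"
    using len by (metis ereal_less_eq(3) order_trans)
  moreover have "(\<Sum>k<m. r) \<le> (\<Sum>k<m. norm (g (ts ! Suc k) - g (ts ! k)))"
    by (intro sum_mono step) auto
  ultimately have "real m * r \<le> l" by simp
  then have "real m \<le> l / r" using \<open>r > 0\<close> by (simp add: field_simps)
  then show ?thesis using lts sts S False by (simp add: m_def card_gt_0_iff of_nat_diff Suc_leI)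
qed

text \<open>
  A maximal \<open>r\<close>-separated set of points of the curve is an \<open>r\<close>-net, and its size is bounded by the
  length.
\<close>

lemma net_of_curve:
  assumes len: "curve_length g \<le> ereal l" and "l > 0" "r > 0"
  obtains C where "finite C" "real (card C) \<le> l / r + 1"
    "\<And>x. x \<in> path_image g \<Longrightarrow> \<exists>c\<in>C. norm (x - c) \<le> r"
proof -
  define sep where "sep S \<longleftrightarrow> finite S \<and> S \<subseteq> {0..1::real} \<and>
    (\<forall>u\<in>S. \<forall>v\<in>S. u \<noteq> v \<longrightarrow> r < norm (g u - g v))" for S
  have bound: "real (card S) \<le> l / r + 1" if "sep S" for S
    using that by (intro separated_points_on_curve[OF assms]) (auto simp: sep_def)
  have "sep {}" by (simp add: sep_def)
  moreover have "\<forall>T. sep T \<longrightarrow> card T < Suc (nat \<lfloor>l / r + 1\<rfloor>)"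
    using bound by (blast intro: le_imp_less_Suc le_nat_floor)
  ultimately have "\<exists>S. sep S \<and> (\<forall>T. sep T \<longrightarrow> card T \<le> card S)"
    by (rule ex_has_greatest_nat)
  then obtain S where S: "sep S" and max: "\<And>T. sep T \<Longrightarrow> card T \<le> card S" by blast
  show ?thesis
  proof
    show "finite (g ` S)" using S by (simp add: sep_def)
    have "card (g ` S) \<le> card S" using S by (intro card_image_le) (simp add: sep_def)
    then show "real (card (g ` S)) \<le> l / r + 1" using bound[OF S] by linarith
  next
    fix x assume "x \<in> path_image g"
    then obtain u where u: "u \<in> {0..1}" "x = g u" by (auto simp: path_image_def)
    show "\<exists>c\<in>g ` S. norm (x - c) \<le> r"
    proof (rule ccontr)
      assume "\<not> ?thesis"
      then have far: "\<And>v. v \<in> S \<Longrightarrow> r < norm (g u - g v)" using u by force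
      then have "u \<notin> S" using \<open>r > 0\<close> by force
      moreover have "sep (insert u S)"
        using S far u by (auto simp: sep_def norm_minus_commute)
      ultimately show False using max[of "insert u S"] S by (simp add: sep_def)
    qed
  qed
qed

lemma curve_length_lipschitz:
  assumes "\<And>u v. 0 \<le> u \<Longrightarrow> u \<le> v \<Longrightarrow> v \<le> 1 \<Longrightarrow> norm (g v - g u) \<le> L * (v - u)" "L \<ge> 0"
  shows "curve_length g \<le> ereal L"
  unfolding curve_length_def
proof (rule SUP_least, clarify)
  fix m and t :: "nat \<Rightarrow> real"
  assume mono: "mono_on {..m} t" and t: "t ` {..m} \<subseteq> {0..1}"
  have "(\<Sum>k<m. norm (g (t (Suc k)) - g (t k))) \<le> (\<Sum>k<m. L * (t (Suc k) - t k))"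
  proof (intro sum_mono assms(1))
    fix k assume "k \<in> {..<m}"
    then have k: "k \<in> {..m}" "Suc k \<in> {..m}" by auto
    show "t k \<le> t (Suc k)" by (rule mono_onD[OF mono k]) simp
    show "0 \<le> t k" "t (Suc k) \<le> 1" using t k by (auto simp: image_subset_iff)
  qed
  also have "\<dots> = L * (t m - t 0)" by (simp add: sum_lessThan_telescope flip: sum_distrib_left)
  also have "\<dots> \<le> L * 1"
  proof (rule mult_left_mono)
    have "t m \<le> 1" "0 \<le> t 0" using t by (auto simp: image_subset_iff)
    then show "t m - t 0 \<le> 1" by simp
  qed fact
  finally show "ereal (\<Sum>k<m. norm (g (t (Suc k)) - g (t k))) \<le> ereal L" by simp
qed

section \<open>Counting grid points in windows\<close>

lemma card_nat_interval_le:
  assumes "R \<ge> 0"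
  shows "finite {k::nat. \<bar>real k - x\<bar> \<le> R}" "real (card {k::nat. \<bar>real k - x\<bar> \<le> R}) \<le> 2 * R + 1"
proof -
  let ?K = "{k::nat. \<bar>real k - x\<bar> \<le> R}" and ?I = "{\<lceil>x - R\<rceil>..\<lfloor>x + R\<rfloor>}"
  have sub: "int ` ?K \<subseteq> ?I"
    by (auto simp: ceiling_le_iff le_floor_iff)
  have "finite (int ` ?K)" by (rule finite_subset[OF sub]) simp
  then show "finite ?K" by (rule finite_imageD) simp
  have "card ?K = card (int ` ?K)" by (simp add: card_image)
  also have "\<dots> \<le> card ?I" by (rule card_mono[OF _ sub]) simp
  finally have "card ?K \<le> nat (\<lfloor>x + R\<rfloor> - \<lceil>x - R\<rceil> + 1)" by simp
  then show "real (card ?K) \<le> 2 * R + 1" using assms by linarith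
qed

lemma card_lattice_disc_le:
  assumes "R \<ge> 0"
  shows "real (card {j \<in> grid n. norm (real_pair j - c) \<le> R}) \<le> (2 * R + 1)^2"
proof -
  obtain a b where c: "c = (a, b)" by fastforce
  let ?A = "{k::nat. \<bar>real k - a\<bar> \<le> R}" and ?B = "{k::nat. \<bar>real k - b\<bar> \<le> R}"
  have "{j \<in> grid n. norm (real_pair j - c) \<le> R} \<subseteq> ?A \<times> ?B"
    using order_trans[OF norm_fst_le[unfolded real_norm_def]] order_trans[OF norm_snd_le[unfolded real_norm_def]]
    by (force simp: c real_pair_def)
  then have "card {j \<in> grid n. norm (real_pair j - c) \<le> R} \<le> card (?A \<times> ?B)"
    by (rule card_mono[rotated]) (intro finite_cartesian_product card_nat_interval_le assms)
  then have "real (card {j \<in> grid n. norm (real_pair j - c) \<le> R}) \<le> real (card ?A) * real (card ?B)"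
    by (simp add: card_cartesian_product flip: of_nat_mult)
  also have "\<dots> \<le> (2 * R + 1)^2"
    unfolding power2_eq_square using assms by (intro mult_mono card_nat_interval_le) auto
  finally show ?thesis .
qed

lemma finite_grid [simp]: "finite (grid n)" and card_grid [simp]: "card (grid n) = n^2"
  by (simp_all add: grid_def power2_eq_square)

lemma window_subset_grid: "window n h i \<subseteq> grid n"
  by (auto simp: window_def)

lemma finite_window [simp]: "finite (window n h i)"
  by (rule finite_subset[OF window_subset_grid finite_grid])

lemma center_in_window: "i \<in> grid n \<Longrightarrow> h > 0 \<Longrightarrow> i \<in> window n h i"
  by (simp add: window_def)

lemma card_window_pos: "i \<in> grid n \<Longrightarrow> h > 0 \<Longrightarrow> card (window n h i) > 0"
  using center_in_window by (fastforce simp: card_gt_0_iff)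

lemma norm_design_point_diff:
  assumes "n \<ge> 1"
  shows "norm (design_point n j - design_point n i) = norm (real_pair j - real_pair i) / real n"
proof -
  have "design_point n j - design_point n i = (1 / real n) *\<^sub>R (real_pair j - real_pair i)"
    by (simp add: design_point_def real_pair_def diff_divide_distrib)
  then show ?thesis by simp
qed

lemma design_point_in_square: "i \<in> grid n \<Longrightarrow> design_point n i \<in> unit_square"
  by (auto simp: grid_def design_point_def unit_square_def divide_simps)

lemma norm_real_pair_diff_le:
  "norm (real_pair j - real_pair i)
    \<le> \<bar>real (fst j) - real (fst i)\<bar> + \<bar>real (snd j) - real (snd i)\<bar>"
  using norm_Pair_le[of "real (fst j) - real (fst i)" "real (snd j) - real (snd i)"]
  by (simp add: real_pair_def)

lemma card_window_le:
  assumes "h > 0"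
  shows "real (card (window n h i)) \<le> (2 * (real n * h) + 1)^2"
  using card_lattice_disc_le[of "real n * h" n "real_pair i"] assms by (simp add: window_def)

lemma card_window_le_card_grid: "card (window n h i) \<le> n^2"
  using card_mono[OF finite_grid window_subset_grid] by (metis card_grid)

text \<open>
  Near the border of the grid only one of the two sides of \<open>a\<close> has room for \<open>p\<close> further points.
\<close>

lemma one_sided_interval:
  fixes a n p :: nat
  assumes "a \<in> {1..n}" "2 * p \<le> n"
  obtains I where "I \<subseteq> {1..n}" "finite I" "card I = p + 1" "\<And>k. k \<in> I \<Longrightarrow> \<bar>real k - real a\<bar> \<le> real p"
proof (cases "a + p \<le> n")
  case True
  with assms show ?thesis by (intro that[of "{a..a + p}"]) auto
next
  case False
  with assms show ?thesis by (intro that[of "{a - p..a}"]) auto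
qed

text \<open>
  In the worst case, a grid corner, a quarter of the disc remains in the grid. The window
  contains a product of two one-sided intervals of length \<open>\<lfloor>n h / 2\<rfloor>\<close>, because the Euclidean norm
  is at most the sum of the two coordinate distances.
\<close>

lemma card_window_ge:
  assumes i: "i \<in> grid n" and "0 < h" "h \<le> 1"
  shows "(real n * h / 2)^2 \<le> real (card (window n h i))"
proof -
  define p where "p = nat \<lfloor>real n * h / 2\<rfloor>"
  have nh: "0 \<le> real n * h" "real n * h \<le> real n"
    using assms by (auto simp: mult_left_le)
  then have p: "real p \<le> real n * h / 2" "real n * h / 2 < real p + 1"
    unfolding p_def by linarith+
  then have "2 * p \<le> n" using nh by linarith
  moreover have "fst i \<in> {1..n}" "snd i \<in> {1..n}" using i by (auto simp: grid_def)
  ultimately obtain I J where I: "I \<subseteq> {1..n}" "finite I" "card I = p + 1" 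
      "\<And>k. k \<in> I \<Longrightarrow> \<bar>real k - real (fst i)\<bar> \<le> real p"
    and J: "J \<subseteq> {1..n}" "finite J" "card J = p + 1" 
      "\<And>k. k \<in> J \<Longrightarrow> \<bar>real k - real (snd i)\<bar> \<le> real p"
    by (metis one_sided_interval)
  have "I \<times> J \<subseteq> window n h i"
  proof
    fix j assume j: "j \<in> I \<times> J"
    then have "\<bar>real (fst j) - real (fst i)\<bar> + \<bar>real (snd j) - real (snd i)\<bar> \<le> real p + real p"
      using I(4)[of "fst j"] J(4)[of "snd j"] by (intro add_mono) auto
    then have "norm (real_pair j - real_pair i) \<le> real n * h"
      using norm_real_pair_diff_le[of j i] p by linarith
    then show "j \<in> window n h i" using j I(1) J(1) by (auto simp: window_def grid_def)
  qed
  then have "card (I \<times> J) \<le> card (window n h i)" by (intro card_mono) auto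
  then have "(p + 1)^2 \<le> card (window n h i)" 
    using I J by (simp add: card_cartesian_product power2_eq_square)
  then have "(real p + 1)^2 \<le> real (card (window n h i))"
    by (metis of_nat_1 of_nat_add of_nat_le_iff of_nat_power)
  moreover have "(real n * h / 2)^2 \<le> (real p + 1)^2" using p nh by (intro power_mono) auto
  ultimately show ?thesis by linarith
qed

section \<open>Bias-variance decomposition of the risk\<close>

locale white_noise = prob_space M for M :: "'a measure" +
  fixes n :: nat and Z :: "nat \<times> nat \<Rightarrow> 'a \<Rightarrow> real"
  assumes indep: "indep_vars (\<lambda>_. borel) Z (grid n)"
    and integrable_square: "i \<in> grid n \<Longrightarrow> integrable M (\<lambda>\<omega>. (Z i \<omega>)^2)"
    and mean_zero: "i \<in> grid n \<Longrightarrow> expectation (Z i) = 0"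
    and second_moment: "i \<in> grid n \<Longrightarrow> expectation (\<lambda>\<omega>. (Z i \<omega>)^2) = 1"
begin

lemma noise_measurable: "i \<in> grid n \<Longrightarrow> Z i \<in> borel_measurable M"
  using indep by (auto simp: indep_vars_def)

lemma noise_integrable: "i \<in> grid n \<Longrightarrow> integrable M (Z i)"
  by (rule square_integrable_imp_integrable[OF noise_measurable integrable_square])

lemma noise_product:
  assumes "i \<in> grid n" "j \<in> grid n"
  shows "integrable M (\<lambda>\<omega>. Z i \<omega> * Z j \<omega>)"
    and "expectation (\<lambda>\<omega>. Z i \<omega> * Z j \<omega>) = (if i = j then 1 else 0)"
proof -
  have *: "integrable M (\<lambda>\<omega>. Z i \<omega> * Z j \<omega>) \<and>
    expectation (\<lambda>\<omega>. Z i \<omega> * Z j \<omega>) = (if i = j then 1 else 0)"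
  proof (cases "i = j")
    case True
    with assms show ?thesis
      using integrable_square[of i] second_moment[of i] by (simp add: power2_eq_square)
  next
    case False
    have "indep_vars (\<lambda>_. borel) Z {i, j}"
      by (rule indep_vars_subset[OF indep]) (use assms in auto)
    moreover have "integrable M (Z k)" if "k \<in> {i, j}" for k
      using that assms noise_integrable[of k] by blast
    ultimately show ?thesis
      using False assms indep_vars_lebesgue_integral[of "{i, j}" Z] indep_vars_integrable[of "{i, j}" Z]
      by (simp add: mean_zero)
  qed
  then show "integrable M (\<lambda>\<omega>. Z i \<omega> * Z j \<omega>)"
    and "expectation (\<lambda>\<omega>. Z i \<omega> * Z j \<omega>) = (if i = j then 1 else 0)" by auto
qed

text \<open>
  The error is a constant plus a linear combination of uncorrelated noise variables; after expanding
  the square, only the diagonal of the double sum has nonzero expectation.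
\<close>

lemma mean_square_error_of_average:
  fixes v :: "nat \<times> nat \<Rightarrow> real"
  assumes W: "W \<subseteq> grid n" "W \<noteq> {}"
  shows "expectation (\<lambda>\<omega>. ((\<Sum>j\<in>W. v j + \<sigma> * Z j \<omega>) / card W - c)^2)
     = ((\<Sum>j\<in>W. v j) / card W - c)^2 + \<sigma>^2 / card W"
proof -
  define b where "b = (\<Sum>j\<in>W. v j) / card W - c"
  define \<tau> where "\<tau> = \<sigma> / card W"
  have fin: "finite W" using W by (auto simp: grid_def intro: finite_subset)
  then have cW: "card W > 0" using W by (simp add: card_gt_0_iff)
  have G: "\<And>j. j \<in> W \<Longrightarrow> j \<in> grid n" using W by auto
  have "((\<Sum>j\<in>W. v j + \<sigma> * Z j \<omega>) / card W - c) = b + \<tau> * (\<Sum>j\<in>W. Z j \<omega>)" for \<omega>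
    by (simp add: b_def \<tau>_def sum.distrib sum_distrib_left [symmetric] add_divide_distrib)
  then have "((\<Sum>j\<in>W. v j + \<sigma> * Z j \<omega>) / card W - c)^2
     = b^2 + (2 * b * \<tau>) * (\<Sum>j\<in>W. Z j \<omega>) + \<tau>^2 * (\<Sum>i\<in>W. \<Sum>j\<in>W. Z i \<omega> * Z j \<omega>)" for \<omega>
    by (simp add: power2_eq_square sum_product[symmetric] algebra_simps)
  then have "expectation (\<lambda>\<omega>. ((\<Sum>j\<in>W. v j + \<sigma> * Z j \<omega>) / card W - c)^2)
     = b^2 + (2 * b * \<tau>) * (\<Sum>j\<in>W. expectation (Z j)) 
       + \<tau>^2 * (\<Sum>i\<in>W. \<Sum>j\<in>W. expectation (\<lambda>\<omega>. Z i \<omega> * Z j \<omega>))"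
    by (simp add: noise_integrable noise_product G prob_space)
  also have "\<dots> = b^2 + \<tau>^2 * card W"
    using fin by (simp add: mean_zero noise_product G sum.delta)
  also have "\<tau>^2 * card W = \<sigma>^2 / card W"
    using cW by (simp add: \<tau>_def power2_eq_square field_simps)
  finally show ?thesis by (simp add: b_def)
qed

end

definition filter_bias :: "nat \<Rightarrow> real \<Rightarrow> (real \<times> real \<Rightarrow> real) \<Rightarrow> nat \<times> nat \<Rightarrow> real" where
  "filter_bias n h f i = linear_filter n h (\<lambda>j. f (design_point n j)) i - f (design_point n i)"

lemma (in white_noise) risk_linear_filter:
  assumes "h > 0"
  shows "risk M n \<sigma> Z (linear_filter n h) f =
    1 / (real n)^2 * (\<Sum>i\<in>grid n. (filter_bias n h f i)^2 + \<sigma>^2 / card (window n h i))"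
proof -
  have "expectation (\<lambda>\<omega>. (linear_filter n h (observation n \<sigma> f Z \<omega>) i - f (design_point n i))^2)
    = (filter_bias n h f i)^2 + \<sigma>^2 / card (window n h i)" if "i \<in> grid n" for i
    unfolding filter_bias_def linear_filter_def observation_def
    using center_in_window[OF that assms]
    by (intro mean_square_error_of_average) (auto simp: window_subset_grid)
  then show ?thesis by (simp add: risk_def)
qed

lemma filter_bias_eq:
  assumes "i \<in> grid n" "h > 0"
  shows "filter_bias n h f i =
    (\<Sum>j\<in>window n h i. f (design_point n j) - f (design_point n i)) / card (window n h i)"
  using card_window_pos[OF assms] center_in_window[OF assms]
  by (auto simp: filter_bias_def linear_filter_def sum_subtractf diff_divide_distrib)

lemma abs_filter_bias_le:
  assumes "i \<in> grid n" "h > 0"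
    and osc: "\<And>j. j \<in> window n h i \<Longrightarrow> \<bar>f (design_point n j) - f (design_point n i)\<bar> \<le> B"
  shows "\<bar>filter_bias n h f i\<bar> \<le> B"
proof -
  have "\<bar>\<Sum>j\<in>window n h i. f (design_point n j) - f (design_point n i)\<bar> \<le> (\<Sum>j\<in>window n h i. B)"
    by (rule order_trans[OF sum_abs sum_mono]) (rule osc)
  then show ?thesis
    using card_window_pos[OF assms(1,2)] by (simp add: filter_bias_eq[OF assms(1,2)] field_simps)
qed

lemma abs_filter_bias_le_1:
  assumes "i \<in> grid n" "h > 0" "f ` unit_square \<subseteq> {0..1}"
  shows "\<bar>filter_bias n h f i\<bar> \<le> 1"
proof (rule abs_filter_bias_le[OF assms(1,2)])
  fix j assume "j \<in> window n h i"
  then have "f (design_point n j) \<in> {0..1}" "f (design_point n i) \<in> {0..1}"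
    using assms window_subset_grid[of n h i] design_point_in_square by blast+
  then show "\<bar>f (design_point n j) - f (design_point n i)\<bar> \<le> 1" by auto
qed

lemma (in white_noise) risk_linear_filter_bounds:
  assumes "h > 0" "n \<ge> 1" "f ` unit_square \<subseteq> {0..1}"
  shows "0 \<le> risk M n \<sigma> Z (linear_filter n h) f" "risk M n \<sigma> Z (linear_filter n h) f \<le> 1 + \<sigma>^2"
proof -
  show "0 \<le> risk M n \<sigma> Z (linear_filter n h) f"
    by (auto simp: risk_linear_filter[OF assms(1)] intro!: divide_nonneg_nonneg sum_nonneg)
  have "(\<Sum>i\<in>grid n. (filter_bias n h f i)^2 + \<sigma>^2 / card (window n h i)) \<le> (\<Sum>i\<in>grid n. 1 + \<sigma>^2)"
  proof (intro sum_mono add_mono)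
    fix i assume i: "i \<in> grid n"
    show "(filter_bias n h f i)^2 \<le> 1"
      using abs_filter_bias_le_1[OF i assms(1,3)] by (simp add: abs_square_le_1)
    have "\<sigma>^2 / card (window n h i) \<le> \<sigma>^2 / 1"
      using card_window_pos[OF i assms(1)] by (intro divide_left_mono) auto
    then show "\<sigma>^2 / card (window n h i) \<le> \<sigma>^2" by simp
  qed
  then show "risk M n \<sigma> Z (linear_filter n h) f \<le> 1 + \<sigma>^2"
    unfolding risk_linear_filter[OF assms(1)] using assms(2) by (simp add: field_simps)
qed

section \<open>Upper bound for the risk\<close>

definition near_curve :: "nat \<Rightarrow> real \<Rightarrow> (real \<Rightarrow> real \<times> real) \<Rightarrow> (nat \<times> nat) set" where
  "near_curve n r g = {i \<in> grid n. \<exists>x\<in>path_image g. norm (x - design_point n i) \<le> r}"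

text \<open>
  Enlarging the discs of an \<open>r\<close>-net of the curve to radius \<open>2 r\<close> covers the whole
  \<open>r\<close>-neighbourhood of the curve.
\<close>

lemma card_near_curve_le:
  assumes "curve_length g \<le> ereal l" "l > 0" "r > 0" "n \<ge> 1"
  shows "real (card (near_curve n r g)) \<le> (l / r + 1) * (4 * (real n * r) + 1)^2"
proof -
  obtain C where C: "finite C" "real (card C) \<le> l / r + 1"
    "\<And>x. x \<in> path_image g \<Longrightarrow> \<exists>c\<in>C. norm (x - c) \<le> r"
    using net_of_curve[OF assms(1-3)] by metis
  define D where "D c = {i \<in> grid n. norm (real_pair i - real n *\<^sub>R c) \<le> 2 * (real n * r)}" for c
  have "near_curve n r g \<subseteq> (\<Union>c\<in>C. D c)"
  proof
    fix i assume "i \<in> near_curve n r g"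
    then obtain x where x: "x \<in> path_image g" "norm (x - design_point n i) \<le> r" and i: "i \<in> grid n"
      by (auto simp: near_curve_def)
    then obtain c where c: "c \<in> C" "norm (x - c) \<le> r" using C(3) by blast
    have "norm (design_point n i - c) \<le> norm (design_point n i - x) + norm (x - c)"
      using norm_triangle_ineq[of "design_point n i - x" "x - c"] by simp
    also have "\<dots> \<le> 2 * r" using x c by (simp add: norm_minus_commute)
    finally have "real n * norm (design_point n i - c) \<le> 2 * (real n * r)"
      using assms(4) by simp
    moreover have "real_pair i = real n *\<^sub>R design_point n i"
      using assms(4) by (simp add: real_pair_def design_point_def)
    then have "real_pair i - real n *\<^sub>R c = real n *\<^sub>R (design_point n i - c)"
      by (simp add: scaleR_diff_right)
    ultimately have "i \<in> D c" using i by (simp add: D_def)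
    then show "i \<in> (\<Union>c\<in>C. D c)" using c by blast
  qed
  then have "card (near_curve n r g) \<le> card (\<Union>c\<in>C. D c)"
    using C(1) by (intro card_mono) (auto simp: D_def)
  also have "\<dots> \<le> (\<Sum>c\<in>C. card (D c))" by (rule card_UN_le[OF C(1)])
  finally have "real (card (near_curve n r g)) \<le> (\<Sum>c\<in>C. real (card (D c)))"
    by (metis of_nat_le_iff of_nat_sum)
  also have "\<dots> \<le> (\<Sum>c\<in>C. (4 * (real n * r) + 1)^2)"
    unfolding D_def using assms card_lattice_disc_le[of "2 * (real n * r)" n] by (intro sum_mono) simp
  also have "\<dots> = real (card C) * (4 * (real n * r) + 1)^2" by simp
  also have "\<dots> \<le> (l / r + 1) * (4 * (real n * r) + 1)^2" by (rule mult_right_mono[OF C(2)]) simp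
  finally show ?thesis .
qed

lemma convex_unit_square: "convex unit_square"
  by (simp add: unit_square_def convex_Times)

lemma abs_filter_bias_le_off_curves:
  assumes i: "i \<in> grid n" and "h > 0"
    and lip: "\<And>x. x \<in> unit_square - (\<Union>g\<in>G. path_image g) \<Longrightarrow> local_lip f x \<le> ereal \<beta>"
    and "\<beta> \<ge> 0" and far: "\<And>g. g \<in> G \<Longrightarrow> i \<notin> near_curve n h g"
  shows "\<bar>filter_bias n h f i\<bar> \<le> \<beta> * h"
proof (rule abs_filter_bias_le[OF assms(1,2)])
  fix j assume j: "j \<in> window n h i"
  then have jg: "j \<in> grid n" using window_subset_grid by blast
  have "n \<ge> 1" using i by (auto simp: grid_def)
  then have dist: "norm (design_point n j - design_point n i) \<le> h"
    using j by (simp add: norm_design_point_diff window_def field_simps)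
  have sq: "closed_segment (design_point n i) (design_point n j) \<subseteq> unit_square"
    by (intro closed_segment_subset design_point_in_square convex_unit_square i jg)
  have "\<bar>f (design_point n j) - f (design_point n i)\<bar> \<le> \<beta> * norm (design_point n j - design_point n i)"
  proof (rule lipschitz_along_segment[OF sq], rule lip)
    fix z assume z: "z \<in> closed_segment (design_point n i) (design_point n j)"
    have "norm (z - design_point n i) \<le> h"
      using segment_bound(1)[OF z] dist by linarith
    then have "z \<notin> path_image g" if "g \<in> G" for g
      using far[OF that] i by (auto simp: near_curve_def)
    then show "z \<in> unit_square - (\<Union>g\<in>G. path_image g)" using z sq by blast
  qed
  also have "\<dots> \<le> \<beta> * h" using dist \<open>\<beta> \<ge> 0\<close> by (rule mult_left_mono)
  finally show "\<bar>f (design_point n j) - f (design_point n i)\<bar> \<le> \<beta> * h" .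
qed

text \<open>
  The three terms come from the grid points near a curve, from the Lipschitz bias elsewhere, and
  from the noise.
\<close>

lemma (in white_noise) risk_linear_filter_le:
  assumes f: "f \<in> CPLIP l \<beta> N" and pos: "l > 0" "\<beta> > 0" and h: "0 < h" "h \<le> 1" "1 \<le> real n * h"
  shows "risk M n \<sigma> Z (linear_filter n h) f
    \<le> 25 * real N * (l + 1) * h + \<beta>^2 * h^2 + 4 * \<sigma>^2 / (real n * h)^2"
proof -
  obtain G where range: "f ` unit_square \<subseteq> {0..1}" and G: "finite G" "card G \<le> N" "G \<subseteq> rect_curves l"
    and lip: "\<And>x. x \<in> unit_square - (\<Union>g\<in>G. path_image g) \<Longrightarrow> local_lip f x \<le> ereal \<beta>"
    using f by (auto simp: CPLIP_def complexes_def)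
  have n: "n \<ge> 1" using h by (cases n) auto
  define bad where "bad = (\<Union>g\<in>G. near_curve n h g)"
  have badsub: "bad \<subseteq> grid n" by (auto simp: bad_def near_curve_def)
  have card_bad: "real (card bad) \<le> (real n)^2 * (25 * real N * (l + 1) * h)"
  proof -
    have "card bad \<le> (\<Sum>g\<in>G. card (near_curve n h g))"
      unfolding bad_def by (rule card_UN_le[OF G(1)])
    then have "real (card bad) \<le> (\<Sum>g\<in>G. real (card (near_curve n h g)))"
      by (metis of_nat_le_iff of_nat_sum)
    also have "\<dots> \<le> (\<Sum>g\<in>G. (l / h + 1) * (4 * (real n * h) + 1)^2)"
      using G(3) pos h n by (intro sum_mono card_near_curve_le) (auto simp: rect_curves_def)
    also have "\<dots> = real (card G) * ((l / h + 1) * (4 * (real n * h) + 1)^2)" by simp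
    \<comment> \<open>The additive 1 is absorbed by \<open>n h \<ge> 1\<close>.\<close>
    also have "\<dots> \<le> real N * ((l / h + 1) * (5 * (real n * h))^2)"
      using G(2) pos h by (intro mult_mono mult_left_mono power_mono) (linarith | simp)+
    also have "(l / h + 1) * (5 * (real n * h))^2 = 25 * (real n)^2 * ((l + h) * h)"
      using h by (simp add: power2_eq_square field_simps)
    also have "\<dots> \<le> 25 * (real n)^2 * ((l + 1) * h)"
      using h by (intro mult_left_mono mult_right_mono) auto
    finally have "real (card bad) \<le> real N * (25 * (real n)^2 * ((l + 1) * h))"
      by (simp add: mult_left_mono)
    then show ?thesis by (simp add: algebra_simps)
  qed
  have point: "(filter_bias n h f i)^2 + \<sigma>^2 / card (window n h i)
     \<le> of_bool (i \<in> bad) + (\<beta>^2 * h^2 + 4 * \<sigma>^2 / (real n * h)^2)" if i: "i \<in> grid n" for i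
  proof -
    have "(filter_bias n h f i)^2 \<le> of_bool (i \<in> bad) + \<beta>^2 * h^2"
    proof (cases "i \<in> bad")
      case True
      have "(filter_bias n h f i)^2 \<le> 1"
        using abs_filter_bias_le_1[OF i h(1) range] by (simp add: abs_square_le_1)
      with True show ?thesis by (simp add: add_increasing2)
    next
      case False
      then have "\<bar>filter_bias n h f i\<bar> \<le> \<beta> * h"
        using pos by (intro abs_filter_bias_le_off_curves[OF i h(1) lip]) (auto simp: bad_def)
      then have "(filter_bias n h f i)^2 \<le> (\<beta> * h)^2" by (rule abs_le_square_iff[THEN iffD1, OF order_trans]) simp
      with False show ?thesis by (simp add: power_mult_distrib)
    qed
    moreover have "\<sigma>^2 / card (window n h i) \<le> \<sigma>^2 / (real n * h / 2)^2"
      using card_window_ge[OF i h(1,2)] h n by (intro divide_left_mono mult_pos_pos) (auto simp: card_window_pos i)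
    moreover have "\<sigma>^2 / (real n * h / 2)^2 = 4 * \<sigma>^2 / (real n * h)^2" by (simp add: power_divide)
    ultimately show ?thesis by linarith
  qed
  have "(\<Sum>i\<in>grid n. (filter_bias n h f i)^2 + \<sigma>^2 / card (window n h i))
     \<le> (\<Sum>i\<in>grid n. of_bool (i \<in> bad) + (\<beta>^2 * h^2 + 4 * \<sigma>^2 / (real n * h)^2))"
    by (rule sum_mono[OF point])
  also have "\<dots> = real (card bad) + (real n)^2 * (\<beta>^2 * h^2 + 4 * \<sigma>^2 / (real n * h)^2)"
    using badsub by (simp add: sum.distrib sum_of_bool_eq Int_absorb2 Int_commute)
  also have "\<dots> \<le> (real n)^2 * (25 * real N * (l + 1) * h + \<beta>^2 * h^2 + 4 * \<sigma>^2 / (real n * h)^2)"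
    using card_bad by (simp add: algebra_simps)
  finally show ?thesis
    unfolding risk_linear_filter[OF h(1)] using n by (simp add: field_simps)
qed

section \<open>Functions with large risk\<close>

definition corner :: "real \<Rightarrow> real \<times> real \<Rightarrow> real" where
  "corner s x = (if fst x \<le> s \<and> snd x \<le> s then 1 else 0)"

text \<open>
  The truncation at \<open>s\<close> makes this the L-shaped path from \<open>(s, 0)\<close> via \<open>(s, s)\<close> to \<open>(0, s)\<close>,
  the part of the boundary of the square across which its indicator jumps.
\<close>

definition corner_curve :: "real \<Rightarrow> real \<Rightarrow> real \<times> real" where
  "corner_curve s t = (min s (2 * s * (1 - t)), min s (2 * s * t))"

lemma corner_curve_in_rect_curves:
  assumes "0 < s" "s \<le> 1" "4 * s \<le> l"
  shows "corner_curve s \<in> rect_curves l"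
proof -
  have "norm (corner_curve s v - corner_curve s u) \<le> (4 * s) * (v - u)" if "u \<le> v" for u v
  proof -
    have "\<bar>min s (2 * s * (1 - v)) - min s (2 * s * (1 - u))\<bar> \<le> \<bar>2 * s * (1 - v) - 2 * s * (1 - u)\<bar>"
      "\<bar>min s (2 * s * v) - min s (2 * s * u)\<bar> \<le> \<bar>2 * s * v - 2 * s * u\<bar>" by linarith+
    moreover have "2 * s * (1 - v) - 2 * s * (1 - u) = - (2 * s * (v - u))" 
      "2 * s * v - 2 * s * u = 2 * s * (v - u)" by (auto simp: algebra_simps)
    moreover have "0 \<le> 2 * s * (v - u)" using assms that by simp
    ultimately have "\<bar>min s (2 * s * (1 - v)) - min s (2 * s * (1 - u))\<bar> \<le> 2 * s * (v - u)"
      "\<bar>min s (2 * s * v) - min s (2 * s * u)\<bar> \<le> 2 * s * (v - u)" by simp_all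
    then have "norm (corner_curve s v - corner_curve s u) \<le> 2 * s * (v - u) + 2 * s * (v - u)"
      unfolding corner_curve_def diff_Pair
      by (intro order_trans[OF norm_Pair_le] add_mono) (simp_all only: real_norm_def)
    then show ?thesis by simp
  qed
  then have "curve_length (corner_curve s) \<le> ereal (4 * s)"
    using assms by (intro curve_length_lipschitz) auto
  also have "\<dots> \<le> ereal l" using assms by simp
  finally have "curve_length (corner_curve s) \<le> ereal l" .
  moreover have "path (corner_curve s)"
    unfolding path_def corner_curve_def by (intro continuous_intros)
  moreover have "path_image (corner_curve s) \<subseteq> unit_square"
    using assms by (auto simp: path_image_def corner_curve_def unit_square_def min.coboundedI1)
  ultimately show ?thesis by (simp add: rect_curves_def)
qed

lemma corner_boundary_on_curve:
  assumes "0 < s" "0 \<le> a" "0 \<le> b" "max a b = s"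
  shows "(a, b) \<in> path_image (corner_curve s)"
proof (cases "a = s")
  case True
  with assms have "corner_curve s (b / (2 * s)) = (a, b)" "b / (2 * s) \<in> {0..1}"
    by (auto simp: corner_curve_def field_simps min_def max_def split: if_splits)
  then show ?thesis by (metis image_eqI path_image_def)
next
  case False
  with assms have "corner_curve s (1 - a / (2 * s)) = (a, b)" "1 - a / (2 * s) \<in> {0..1}"
    by (auto simp: corner_curve_def field_simps min_def max_def split: if_splits)
  then show ?thesis by (metis image_eqI path_image_def)
qed

text \<open>
  Off the curve \<open>max (fst x) (snd x)\<close> differs from \<open>s\<close>, and the sign of the difference, hence the
  value of the indicator, is the same at all points closer than that difference.
\<close>

lemma corner_in_CPLIP:
  assumes s: "0 < s" "s \<le> 1" "4 * s \<le> l" and "N \<ge> 1" "\<beta> > 0"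
  shows "corner s \<in> CPLIP l \<beta> N"
proof -
  have "local_lip (corner s) x \<le> ereal \<beta>" if x: "x \<in> unit_square - path_image (corner_curve s)" for x
  proof -
    obtain a b where ab: "x = (a, b)" by fastforce
    then have nonneg: "0 \<le> a" "0 \<le> b" using x by (auto simp: unit_square_def)
    then have ne: "max a b \<noteq> s" using corner_boundary_on_curve[OF s(1)] x ab by blast
    define \<delta> where "\<delta> = \<bar>max a b - s\<bar> / 2"
    have "local_lip (corner s) x \<le> 0"
    proof (rule local_lip_locally_constant)
      show "\<delta> > 0" using ne by (simp add: \<delta>_def)
      fix y assume "norm (y - x) \<le> \<delta>"
      then have "\<bar>fst y - a\<bar> \<le> \<delta>" "\<bar>snd y - b\<bar> \<le> \<delta>"
        using norm_fst_le[of "fst (y - x)" "snd (y - x)"] norm_snd_le[of "snd (y - x)" "fst (y - x)"] ab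
        by (auto simp del: fst_diff snd_diff) (auto)
      then show "corner s y = corner s x"
        using ne unfolding \<delta>_def corner_def ab fst_conv snd_conv by (smt (verit) field_sum_of_halves)
    qed
    also have "0 \<le> ereal \<beta>" using assms by simp
    finally show ?thesis .
  qed
  moreover have "{corner_curve s} \<in> complexes N l"
    using corner_curve_in_rect_curves[OF s] \<open>N \<ge> 1\<close> by (simp add: complexes_def)
  ultimately show ?thesis by (auto simp: CPLIP_def corner_def intro!: bexI[of _ "{corner_curve s}"])
qed

lemma zero_in_CPLIP:
  assumes "\<beta> > 0"
  shows "(\<lambda>x. 0) \<in> CPLIP l \<beta> N"
proof -
  have "local_lip (\<lambda>x. 0) x \<le> ereal \<beta>" for x
    using local_lip_locally_constant[of 1 x "\<lambda>x. 0"] assms by (simp add: order_trans)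
  then show ?thesis by (auto simp: CPLIP_def complexes_def intro!: exI[of _ "{}"])
qed

text \<open>
  The parameter \<open>q\<close> is the number of grid columns inside the square. For a point among its last \<open>p\<close>
  columns, the \<open>p \<times> p\<close> block that starts in column \<open>q + 1\<close> and in the row of the point is at
  distance at most \<open>3 p\<close>, hence inside the window, while the function vanishes on it.
\<close>

lemma corner_bias_ge:
  assumes q: "q = nat \<lfloor>s * real n\<rfloor>" "s \<ge> 0" and p: "p \<le> q" "2 * q \<le> n" "3 * real p \<le> real n * h" and "h > 0"
    and i: "fst i \<in> {q - p<..q}" "snd i \<in> {1..q}"
  shows "(real p)^2 / real (card (window n h i)) \<le> \<bar>filter_bias n h (corner s) i\<bar>"
proof -
  have n: "n \<ge> 1" and ig: "i \<in> grid n" using i p by (cases i; auto simp: grid_def)+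
  have val: "corner s (design_point n j) = of_bool (fst j \<le> q \<and> snd j \<le> q)" for j
  proof -
    have "real k / real n \<le> s \<longleftrightarrow> k \<le> q" for k
    proof -
      have "real k / real n \<le> s \<longleftrightarrow> real k \<le> s * real n" using n by (simp add: field_simps)
      also have "\<dots> \<longleftrightarrow> k \<le> q" using q by (simp add: le_nat_iff le_floor_iff)
      finally show ?thesis .
    qed
    then show ?thesis by (simp add: corner_def design_point_def)
  qed
  define J where "J = {q<..q + p} \<times> {snd i..<snd i + p}"
  have "J \<subseteq> window n h i"
  proof
    fix j assume j: "j \<in> J"
    then have "\<bar>real (fst j) - real (fst i)\<bar> \<le> 2 * real p" "\<bar>real (snd j) - real (snd i)\<bar> \<le> real p"
      using i p by (auto simp: J_def)
    then have "norm (real_pair j - real_pair i) \<le> real n * h"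
      using norm_real_pair_diff_le[of j i] p by linarith
    moreover have "j \<in> grid n" using j i p by (auto simp: J_def grid_def)
    ultimately show "j \<in> window n h i" by (simp add: window_def)
  qed
  then have "(\<Sum>j\<in>J. 1 - corner s (design_point n j)) \<le> (\<Sum>j\<in>window n h i. 1 - corner s (design_point n j))"
    by (intro sum_mono2) (auto simp: corner_def)
  also have "(\<Sum>j\<in>J. 1 - corner s (design_point n j)) = (\<Sum>j\<in>J. 1)"
    by (intro sum.cong) (auto simp: val J_def)
  also have "\<dots> = (real p)^2" by (simp add: J_def card_cartesian_product power2_eq_square)
  also have "corner s (design_point n i) = 1" using i by (simp add: val)
  then have "(\<Sum>j\<in>window n h i. 1 - corner s (design_point n j))
     = - (\<Sum>j\<in>window n h i. corner s (design_point n j) - corner s (design_point n i))"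
    by (simp add: sum_negf[symmetric])
  finally have "(real p)^2 / real (card (window n h i)) \<le> - filter_bias n h (corner s) i"
    unfolding filter_bias_eq[OF ig \<open>h > 0\<close>] minus_divide_left by (rule divide_right_mono) simp
  then show ?thesis by linarith
qed

text \<open>
  There are \<open>p q\<close> grid points to which the bias bound applies.
\<close>

lemma (in white_noise) corner_risk_ge:
  assumes q: "q = nat \<lfloor>s * real n\<rfloor>" "s \<ge> 0" and p: "p \<le> q" "2 * q \<le> n" "3 * real p \<le> real n * h" and "h > 0"
    and K: "\<And>i. real (card (window n h i)) \<le> K"
  shows "real p * real q / (real n)^2 * ((real p)^2 / K)^2 \<le> risk M n \<sigma> Z (linear_filter n h) (corner s)"
proof -
  define B where "B = {q - p<..q} \<times> {1..q}"
  have B: "B \<subseteq> grid n" "finite B" "card B = p * q"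
    using p by (auto simp: B_def grid_def card_cartesian_product)
  have "((real p)^2 / K)^2 \<le> (filter_bias n h (corner s) i)^2 + \<sigma>^2 / card (window n h i)" if "i \<in> B" for i
  proof -
    have "i \<in> grid n" using that B by auto
    then have W: "card (window n h i) > 0" using \<open>h > 0\<close> by (rule card_window_pos)
    then have "K > 0" using K[of i] by linarith
    then have "(real p)^2 / K \<le> (real p)^2 / card (window n h i)"
      using K[of i] W by (intro divide_left_mono) auto
    also have "\<dots> \<le> \<bar>filter_bias n h (corner s) i\<bar>"
      using that by (intro corner_bias_ge[OF assms(1-6)]) (auto simp: B_def)
    finally have "((real p)^2 / K)^2 \<le> \<bar>filter_bias n h (corner s) i\<bar>^2"
      using \<open>K > 0\<close> by (intro power_mono) auto
    then show ?thesis by (simp add: add_increasing2)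
  qed
  then have "(\<Sum>i\<in>B. ((real p)^2 / K)^2) \<le> (\<Sum>i\<in>B. (filter_bias n h (corner s) i)^2 + \<sigma>^2 / card (window n h i))"
    by (rule sum_mono)
  also have "\<dots> \<le> (\<Sum>i\<in>grid n. (filter_bias n h (corner s) i)^2 + \<sigma>^2 / card (window n h i))"
    using B by (intro sum_mono2) auto
  finally show ?thesis
    unfolding risk_linear_filter[OF \<open>h > 0\<close>] using B by (simp add: divide_right_mono)
qed

lemma (in white_noise) zero_risk_ge:
  assumes "h > 0" "n \<ge> 1"
  shows "\<sigma>^2 / (2 * (real n * h) + 1)^2 \<le> risk M n \<sigma> Z (linear_filter n h) (\<lambda>x. 0)"
proof -
  have "(\<Sum>i\<in>grid n. \<sigma>^2 / (2 * (real n * h) + 1)^2) \<le> 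
      (\<Sum>i\<in>grid n. (filter_bias n h (\<lambda>x. 0) i)^2 + \<sigma>^2 / card (window n h i))"
  proof (rule sum_mono)
    fix i assume "i \<in> grid n"
    then have "\<sigma>^2 / (2 * (real n * h) + 1)^2 \<le> \<sigma>^2 / card (window n h i)"
      using card_window_pos[OF _ assms(1), of i n] card_window_le[OF assms(1), of n i]
      by (intro divide_left_mono mult_pos_pos) auto
    then show "\<sigma>^2 / (2 * (real n * h) + 1)^2 \<le> (filter_bias n h (\<lambda>x. 0) i)^2 + \<sigma>^2 / card (window n h i)"
      by (simp add: add_increasing)
  qed
  then show ?thesis
    unfolding risk_linear_filter[OF assms(1)] using assms(2) by (simp add: field_simps)
qed

section \<open>The optimal rate\<close>

context white_noise
begin

text \<open>
  The supremum is taken in the reals, so its upper bound property rests on the uniform bound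
  \<open>1 + \<sigma>\<^sup>2\<close> for the risks.
\<close>

lemma risk_le_worst_case_risk:
  assumes "h > 0" "n \<ge> 1" "f \<in> CPLIP l \<beta> N"
  shows "risk M n \<sigma> Z (linear_filter n h) f \<le> worst_case_risk M n \<sigma> Z (linear_filter n h) (CPLIP l \<beta> N)"
  unfolding worst_case_risk_def
proof (rule cSUP_upper[OF assms(3)])
  show "bdd_above (risk M n \<sigma> Z (linear_filter n h) ` CPLIP l \<beta> N)"
    using risk_linear_filter_bounds(2)[OF assms(1,2)] by (intro bdd_aboveI2[of _ _ "1 + \<sigma>^2"]) (auto simp: CPLIP_def)
qed

lemma worst_case_risk_nonneg:
  assumes "h > 0" "n \<ge> 1" "\<beta> > 0"
  shows "0 \<le> worst_case_risk M n \<sigma> Z (linear_filter n h) (CPLIP l \<beta> N)"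
  using risk_linear_filter_bounds(1)[OF assms(1,2)] risk_le_worst_case_risk[OF assms(1,2) zero_in_CPLIP[OF assms(3)]]
  by (rule order_trans) auto

lemma optimal_risk_le:
  assumes "n \<ge> 1" "l > 0" "\<beta> > 0"
  shows "(INF h\<in>{0::real<..}. worst_case_risk M n \<sigma> Z (linear_filter n h) (CPLIP l \<beta> N))
    \<le> (25 * real N * (l + 1) + \<beta>^2 + 4 * \<sigma>^2) * real n powr (-2/3)"
proof -
  define h where "h = real n powr (-2/3)"
  have h: "0 < h" "h \<le> 1" 
    using assms powr_mono[of "-2/3" 0 "real n"] by (auto simp: h_def)
  have nh: "real n * h = real n powr (1/3)"
    using assms powr_add[of "real n" 1 "-2/3"] by (simp add: h_def)
  then have nh1: "1 \<le> real n * h" using assms by (simp add: ge_one_powr_ge_zero)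
  have sq: "1 / (real n * h)^2 = h"
    unfolding nh using assms
    by (simp add: h_def powr_minus_divide flip: powr_realpow powr_numeral add: powr_powr)
  have "h^2 \<le> h" using h by (simp add: power2_eq_square mult_left_le)
  have "(INF h\<in>{0::real<..}. worst_case_risk M n \<sigma> Z (linear_filter n h) (CPLIP l \<beta> N))
      \<le> worst_case_risk M n \<sigma> Z (linear_filter n h) (CPLIP l \<beta> N)"
    using h assms worst_case_risk_nonneg by (intro cINF_lower bdd_belowI2[of _ 0]) auto
  also have "\<dots> \<le> (25 * real N * (l + 1) + \<beta>^2 + 4 * \<sigma>^2) * h"
    unfolding worst_case_risk_def
  proof (rule cSUP_least)
    show "CPLIP l \<beta> N \<noteq> {}" using zero_in_CPLIP[OF assms(3)] by blast
    fix f assume "f \<in> CPLIP l \<beta> N"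
    from risk_linear_filter_le[OF this assms(2,3) h nh1]
    have "risk M n \<sigma> Z (linear_filter n h) f
      \<le> 25 * real N * (l + 1) * h + \<beta>^2 * h^2 + 4 * \<sigma>^2 * (1 / (real n * h)^2)" by simp
    also have "\<dots> \<le> 25 * real N * (l + 1) * h + \<beta>^2 * h + 4 * \<sigma>^2 * h"
      unfolding sq using \<open>h^2 \<le> h\<close> by (intro add_mono order_refl mult_left_mono) auto
    finally show "risk M n \<sigma> Z (linear_filter n h) f \<le> (25 * real N * (l + 1) + \<beta>^2 + 4 * \<sigma>^2) * h"
      by (simp add: algebra_simps)
  qed
  finally show ?thesis by (simp add: h_def)
qed

text \<open>
  The constant \<open>1370928 = 48 * 169\<^sup>2\<close> collects the losses for bandwidths with \<open>2 n h + 1 > x\<close>, where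
  \<open>x = n powr (1/3)\<close>: there \<open>p q / n\<^sup>2 \<ge> s\<^sup>2 / (48 x\<^sup>2)\<close>, and the bias is at least \<open>s\<^sup>2 / 169\<close>.
  The lower bound on \<open>n\<close> ensures \<open>x \<ge> 12\<close>.
\<close>

lemma worst_case_risk_ge:
  assumes s: "0 < s" "s \<le> 1/2" "4 * s \<le> l" and "N \<ge> 1" "\<beta> > 0"
    and n: "n \<ge> 1728" "s * real n \<ge> 2" and "h > 0"
  shows "min (\<sigma>^2) (s^6 / 1370928) * real n powr (-2/3)
    \<le> worst_case_risk M n \<sigma> Z (linear_filter n h) (CPLIP l \<beta> N)"
proof -
  define x where "x = real n powr (1/3)"
  have x3: "x^3 = real n" and rate: "real n powr (-2/3) = 1 / x^2"
    using n by (simp_all add: x_def powr_minus_divide flip: powr_realpow powr_numeral add: powr_powr)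
  have x0: "x \<ge> 0" by (simp add: x_def)
  have "12^3 \<le> x^3" using n x3 by simp
  then have x12: "12 \<le> x" using x0 by (smt (verit) power_strict_mono zero_less_numeral)
  show ?thesis
  proof (cases "2 * (real n * h) + 1 \<le> x")
    case True
    have "min (\<sigma>^2) (s^6 / 1370928) * real n powr (-2/3) \<le> \<sigma>^2 * (1 / x^2)"
      unfolding rate by (intro mult_right_mono) auto
    also have "\<dots> \<le> \<sigma>^2 / (2 * (real n * h) + 1)^2"
    proof -
      have "0 < 2 * (real n * h) + 1" using \<open>h > 0\<close> by (simp add: add_nonneg_pos)
      then show ?thesis using True x12
        by (auto intro!: divide_left_mono power_mono)
    qed
    also have "\<dots> \<le> risk M n \<sigma> Z (linear_filter n h) (\<lambda>x. 0)"
      using n \<open>h > 0\<close> by (intro zero_risk_ge) auto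
    also have "\<dots> \<le> worst_case_risk M n \<sigma> Z (linear_filter n h) (CPLIP l \<beta> N)"
      using n \<open>h > 0\<close> \<open>\<beta> > 0\<close> by (intro risk_le_worst_case_risk zero_in_CPLIP) auto
    finally show ?thesis .
  next
    case False
    define q where "q = nat \<lfloor>s * real n\<rfloor>"
    \<comment> \<open>The layer beside the edge has the width of the window, unless the window outgrows the square.\<close>
    define p\<^sub>0 where "p\<^sub>0 = nat \<lfloor>real n * h / 3\<rfloor>"
    define p where "p = min p\<^sub>0 q"
    \<comment> \<open>A bound on the window size that is valid in both cases: through the bandwidth if \<open>p = p\<^sub>0\<close>,
      through the size of the grid if \<open>p = q\<close>.\<close>
    define K where "K = (13 * real p / s)^2"
    have q: "real q \<le> s * real n" "s * real n / 2 \<le> real q"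
      unfolding q_def using n(2) by linarith+
    have "s * real n \<le> 1/2 * real n" using s by (intro mult_right_mono) auto
    then have q2: "2 * q \<le> n" using q by linarith
    have nh: "x / 4 \<le> real n * h" "5 \<le> real n * h" using False x12 by linarith+
    have p0: "3 * real p\<^sub>0 \<le> real n * h" "real n * h / 3 < real p\<^sub>0 + 1"
      unfolding p\<^sub>0_def using nh(2) by linarith+
    have "1 \<le> p\<^sub>0" using p0(2) nh(2) by linarith
    then have nh_le: "real n * h \<le> 6 * real p\<^sub>0" using p0(2) by linarith
    have p: "p \<le> q" "3 * real p \<le> real n * h" using p0(1) by (auto simp: p_def)
    have p_ge: "s * x / 24 \<le> real p"
    proof -
      have "s * x \<le> 1 * x" using s x0 by (intro mult_right_mono) auto
      then have "s * x / 24 \<le> real p\<^sub>0" using nh(1) nh_le by linarith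
      moreover have "x \<le> x^3" using x12 power_increasing[of 1 3 x] by simp
      then have "s * x \<le> s * real n" unfolding x3 using s by (intro mult_left_mono) auto
      then have "s * x / 24 \<le> real q" using q(2) s x0 mult_nonneg_nonneg[of s x] by linarith
      ultimately show ?thesis by (simp add: p_def)
    qed
    then have p_pos: "0 < real p" using s x12 by (intro less_le_trans[OF _ p_ge]) simp
    have card_le: "real (card (window n h i)) \<le> K" for i
    proof (cases "p\<^sub>0 \<le> q")
      case True
      have "real (card (window n h i)) \<le> (2 * (real n * h) + 1)^2"
        by (rule card_window_le[OF \<open>h > 0\<close>])
      also have "\<dots> \<le> K"
      proof -
        have "2 * (real n * h) + 1 \<le> 13 * real p" using True nh_le \<open>1 \<le> p\<^sub>0\<close> by (simp add: p_def)
        also have "\<dots> \<le> 13 * real p / s" using s p_pos by (simp add: field_simps)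
        finally show ?thesis unfolding K_def using nh(2) by (intro power_mono) auto
      qed
      finally show ?thesis .
    next
      case False
      then have "s * real n \<le> 13 * real p" using q by (simp add: p_def)
      then have "real n \<le> 13 * real p / s" using s by (simp add: field_simps)
      then have "(real n)^2 \<le> K" unfolding K_def by (intro power_mono) auto
      moreover have "real (card (window n h i)) \<le> (real n)^2"
        using card_window_le_card_grid[of n h i] by (metis of_nat_le_iff of_nat_power)
      ultimately show ?thesis by linarith
    qed
    have n0: "0 < real n" using n by simp
    have "min (\<sigma>^2) (s^6 / 1370928) * real n powr (-2/3) \<le> s^6 / 1370928 * (1 / x^2)"
      unfolding rate by (intro mult_right_mono) auto
    also have "\<dots> = (s * x / 24) * (s * real n / 2) / (real n)^2 * (s^2 / 169)^2"
      unfolding x3[symmetric] using x12 by (simp add: field_simps power_eq_if)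
    also have "\<dots> \<le> real p * real q / (real n)^2 * (s^2 / 169)^2"
      using p_ge q(2) s x0 by (intro mult_right_mono divide_right_mono mult_mono) auto
    also have "s^2 / 169 = (real p)^2 / K"
      using p_pos s by (simp add: K_def power_mult_distrib power_divide)
    also have "real p * real q / (real n)^2 * ((real p)^2 / K)^2
        \<le> risk M n \<sigma> Z (linear_filter n h) (corner s)"
      using s by (intro corner_risk_ge[OF q_def _ p(1) q2 p(2) \<open>h > 0\<close> card_le]) auto
    also have "\<dots> \<le> worst_case_risk M n \<sigma> Z (linear_filter n h) (CPLIP l \<beta> N)"
      using n \<open>h > 0\<close> s assms(4,5) by (intro risk_le_worst_case_risk corner_in_CPLIP) auto
    finally show ?thesis .
  qed
qed

end

theorem theorem3p1:
  fixes \<sigma> l \<beta> :: real and N :: nat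
    and \<Psi> :: "real measure"
    and M :: "nat \<Rightarrow> 'a measure"
    and Z :: "nat \<Rightarrow> nat \<times> nat \<Rightarrow> 'a \<Rightarrow> real"
  assumes "\<sigma> > 0" and "l > 0" and "N \<ge> 1" and "\<beta> > 0"
    and "prob_space \<Psi>" and "sets \<Psi> = sets borel"
    and "integrable \<Psi> (\<lambda>x. x)" and "integrable \<Psi> (\<lambda>x. x^2)"
    and "prob_space.expectation \<Psi> (\<lambda>x. x) = 0"
    and "prob_space.variance \<Psi> (\<lambda>x. x) = 1"
    and "\<And>n. prob_space (M n)"
    and "\<And>n. prob_space.indep_vars (M n) (\<lambda>_. borel) (Z n) (grid n)"
    and "\<And>n i. i \<in> grid n \<Longrightarrow> distr (M n) borel (Z n i) = \<Psi>"
  shows "(\<lambda>n. INF h\<in>{0::real<..}.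
             worst_case_risk (M n) n \<sigma> (Z n) (linear_filter n h) (CPLIP l \<beta> N))
           \<in> \<Theta>(\<lambda>n. real n powr (-2/3))"
proof -
  have noise: "white_noise (M n) n (Z n)" for n
  proof -
    interpret prob_space "M n" by fact
    have meas: "Z n i \<in> borel_measurable (M n)" if "i \<in> grid n" for i
      using assms(12)[of n] that by (auto simp: indep_vars_def)
    show ?thesis
    proof unfold_locales
      show "indep_vars (\<lambda>_. borel) (Z n) (grid n)" by fact
    next
      fix i assume i: "i \<in> grid n"
      note \<Psi> = assms(13)[OF i]
      show "integrable (M n) (\<lambda>\<omega>. (Z n i \<omega>)^2)"
        using assms(8) integrable_distr_eq[OF meas[OF i], of "\<lambda>x. x^2"] by (simp add: \<Psi>)
      show "expectation (Z n i) = 0"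
        using assms(9) integral_distr[OF meas[OF i], of "\<lambda>x. x"] by (simp add: \<Psi>)
      show "expectation (\<lambda>\<omega>. (Z n i \<omega>)^2) = 1"
        using assms(9,10) integral_distr[OF meas[OF i], of "\<lambda>x. x^2"] by (simp add: \<Psi>)
    qed
  qed
  let ?R = "\<lambda>n. INF h\<in>{0::real<..}.
             worst_case_risk (M n) n \<sigma> (Z n) (linear_filter n h) (CPLIP l \<beta> N)"
  \<comment> \<open>Each coordinate of the L-shaped curve has speed at most \<open>2 s\<close>, so its length is at most \<open>4 s\<close>;
    the bound 1/2 leaves room in the grid beyond the corner square.\<close>
  define s where "s = min (1/2) (l / 4)"
  have s: "0 < s" "s \<le> 1/2" "4 * s \<le> l" using \<open>l > 0\<close> by (auto simp: s_def)
  define c where "c = min (\<sigma>^2) (s^6 / 1370928)"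
  define C where "C = 25 * real N * (l + 1) + \<beta>^2 + 4 * \<sigma>^2"
  have "c > 0" using s \<open>\<sigma> > 0\<close> by (simp add: c_def)
  have lower: "c * real n powr (-2/3) \<le> ?R n" if "n \<ge> 1728" "s * real n \<ge> 2" for n
    unfolding c_def
    by (rule cINF_greatest) (use s assms(3,4) that white_noise.worst_case_risk_ge[OF noise] in auto)
  have "\<forall>\<^sub>F n in sequentially. s * real n \<ge> 2"
    using eventually_ge_at_top[of "nat \<lceil>2 / s\<rceil>"]
  proof eventually_elim
    case (elim n)
    then have "2 / s \<le> real n" by linarith
    then show ?case using s by (simp add: field_simps)
  qed
  then have low: "\<forall>\<^sub>F n in sequentially. c * real n powr (-2/3) \<le> ?R n"
    using eventually_ge_at_top[of 1728] by eventually_elim (rule lower)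
  have up: "\<forall>\<^sub>F n in sequentially. ?R n \<le> C * real n powr (-2/3)"
    using eventually_ge_at_top[of 1]
    by eventually_elim (use white_noise.optimal_risk_le[OF noise] assms(2,4) in \<open>auto simp: C_def\<close>)
  show ?thesis
  proof (rule bigthetaI)
    show "?R \<in> O(\<lambda>n. real n powr (-2/3))"
      using low up
    proof (intro bigoI[of _ C], eventually_elim)
      case (elim n)
      have "0 \<le> c * real n powr (-2/3)" using \<open>c > 0\<close> by simp
      then have "0 \<le> ?R n" using elim by linarith
      then show ?case using elim by simp
    qed
    show "?R \<in> \<Omega>(\<lambda>n. real n powr (-2/3))"
      using low
    proof (intro landau_omega.bigI[of c], simp add: \<open>c > 0\<close>, eventually_elim)
      case (elim n)
      then show ?case by simp
    qed
  qed
qed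

end
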